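(* An algebra $\mathbf B=\langle B,\land,\lor,\otimes,\oplus,\supset,\neg\rangle$ is an implicative bilattice if and only if $\mathbf B$ is isomorphic to the product bilattice $\mathbf L\odot\mathbf L$, for some classical implicative lattice $\mathbf L=\langle L,\sqcap,\sqcup,\backslash,1\rangle$, endowed with the operation $\supset$ defined by $\langle a_1,a_2\rangle\supset\langle b_1,b_2\rangle=\langle a_1\backslash b_1,\ a_1\sqcap b_2\rangle$ for all $a_1,a_2,b_1,b_2\in L$.
   Context: A bilattice is an algebra $\langle B,\land,\lor,\otimes,\oplus,\neg\rangle$ such that $\langle B,\land,\lor\rangle$ and $\langle B,\otimes,\oplus\rangle$ are lattices (not necessarily bounded) with orders $\leq_t$ and $\leq_k$, and $\neg$ is unary with: $a\leq_t b\Rightarrow\neg b\leq_t\neg a$; $a\leq_k b\Rightarrow\neg a\leq_k\neg b$; $\neg\neg a=a$. An implicative bilattice is an algebra $\langle B,\land,\lor,\otimes,\oplus,\supset,\neg\rangle$ whose $\supset$-free reduct is a bilattice and which satisfies: (IB1) $(x\supset x)\supset y\approx y$; (IB2) $x\supset(y\supset z)\approx(x\land y)\supset z\approx(x\otimes y)\supset z$; (IB3) $((x\supset y)\supset x)\supset x\approx x\supset x$; (IB4) $(x\lor y)\supset z\approx(x\supset z)\land(y\supset z)\approx(x\oplus y)\supset z$; (IB5) $x\land((x\supset y)\supset(x\otimes y))\approx x$; (IB6) $\neg(x\supset y)\supset z\approx(x\land\neg y)\supset z$. A classical implicative lattice is a relatively complemented distributive lattice $\langle L,\sqcap,\sqcup\rangle$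 with maximum $1$; for $a,b\in L$, $a\backslash b$ denotes the relative complement of $a$ in $[a\sqcap b,1]$, i.e. the unique element with $a\sqcap(a\backslash b)=a\sqcap b$ and $a\sqcup(a\backslash b)=1$. The product bilattice $\mathbf L\odot\mathbf L$ has universe $L\times L$ and operations $\langle a_1,a_2\rangle\land\langle b_1,b_2\rangle=\langle a_1\sqcap b_1,a_2\sqcup b_2\rangle$, $\langle a_1,a_2\rangle\lor\langle b_1,b_2\rangle=\langle a_1\sqcup b_1,a_2\sqcap b_2\rangle$, $\langle a_1,a_2\rangle\otimes\langle b_1,b_2\rangle=\langle a_1\sqcap b_1,a_2\sqcap b_2\rangle$, $\langle a_1,a_2\rangle\oplus\langle b_1,b_2\rangle=\langle a_1\sqcup b_1,a_2\sqcup b_2\rangle$, $\neg\langle a_1,a_2\rangle=\langle a_2,a_1\rangle$. *)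

theory Defs
  imports "HOL-Algebra.Congruence"
begin

section \<open>Lattices as algebras on a carrier\<close>

locale lattice_on =
  fixes A :: "'a set" and m j :: "'a \<Rightarrow> 'a \<Rightarrow> 'a"
  assumes nonempty: "A \<noteq> {}"
    and meet_closed: "\<lbrakk>x \<in> A; y \<in> A\<rbrakk> \<Longrightarrow> m x y \<in> A"
    and join_closed: "\<lbrakk>x \<in> A; y \<in> A\<rbrakk> \<Longrightarrow> j x y \<in> A"
    and meet_comm: "\<lbrakk>x \<in> A; y \<in> A\<rbrakk> \<Longrightarrow> m x y = m y x"
    and join_comm: "\<lbrakk>x \<in> A; y \<in> A\<rbrakk> \<Longrightarrow> j x y = j y x"
    and meet_assoc: "\<lbrakk>x \<in> A; y \<in> A; z \<in> A\<rbrakk> \<Longrightarrow> m (m x y) z = m x (m y z)"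
    and join_assoc: "\<lbrakk>x \<in> A; y \<in> A; z \<in> A\<rbrakk> \<Longrightarrow> j (j x y) z = j x (j y z)"
    and meet_join_absorb: "\<lbrakk>x \<in> A; y \<in> A\<rbrakk> \<Longrightarrow> m x (j x y) = x"
    and join_meet_absorb: "\<lbrakk>x \<in> A; y \<in> A\<rbrakk> \<Longrightarrow> j x (m x y) = x"

definition le_of :: "('a \<Rightarrow> 'a \<Rightarrow> 'a) \<Rightarrow> 'a \<Rightarrow> 'a \<Rightarrow> bool" where
  "le_of m x y \<longleftrightarrow> m x y = x"


section \<open>Bilattices and implicative bilattices\<close>

record 'a bilattice_alg = "'a partial_object" +
  tmeet :: "'a \<Rightarrow> 'a \<Rightarrow> 'a" (infixl \<open>\<curlywedge>\<index>\<close> 70)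
  tjoin :: "'a \<Rightarrow> 'a \<Rightarrow> 'a" (infixl \<open>\<curlyvee>\<index>\<close> 65)
  kmeet :: "'a \<Rightarrow> 'a \<Rightarrow> 'a" (infixl \<open>\<otimes>\<index>\<close> 70)
  kjoin :: "'a \<Rightarrow> 'a \<Rightarrow> 'a" (infixl \<open>\<oplus>\<index>\<close> 65)
  neg :: "'a \<Rightarrow> 'a" (\<open>\<sim>\<index> _\<close> [81] 80)

record 'a implicative_alg = "'a bilattice_alg" +
  impl :: "'a \<Rightarrow> 'a \<Rightarrow> 'a" (infixr \<open>\<sqsupset>\<index>\<close> 60)

text \<open>Operations are total on the underlying type, so being an algebra of this signature
  means that the carrier is nonempty and closed under all of them.\<close>

locale implicative_algebra =
  fixes B (structure)
  assumes nonempty: "carrier B \<noteq> {}"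
    and tmeet_closed: "\<lbrakk>x \<in> carrier B; y \<in> carrier B\<rbrakk> \<Longrightarrow> x \<curlywedge> y \<in> carrier B"
    and tjoin_closed: "\<lbrakk>x \<in> carrier B; y \<in> carrier B\<rbrakk> \<Longrightarrow> x \<curlyvee> y \<in> carrier B"
    and kmeet_closed: "\<lbrakk>x \<in> carrier B; y \<in> carrier B\<rbrakk> \<Longrightarrow> x \<otimes> y \<in> carrier B"
    and kjoin_closed: "\<lbrakk>x \<in> carrier B; y \<in> carrier B\<rbrakk> \<Longrightarrow> x \<oplus> y \<in> carrier B"
    and impl_closed: "\<lbrakk>x \<in> carrier B; y \<in> carrier B\<rbrakk> \<Longrightarrow> x \<sqsupset> y \<in> carrier B"
    and neg_closed: "x \<in> carrier B \<Longrightarrow> \<sim> x \<in> carrier B"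

locale bilattice =
  t: lattice_on "carrier B" "tmeet B" "tjoin B" +
  k: lattice_on "carrier B" "kmeet B" "kjoin B"
  for B (structure) +
  assumes neg_closed: "x \<in> carrier B \<Longrightarrow> \<sim> x \<in> carrier B"
    and neg_antitone_t: "\<lbrakk>x \<in> carrier B; y \<in> carrier B; le_of (tmeet B) x y\<rbrakk>
      \<Longrightarrow> le_of (tmeet B) (\<sim> y) (\<sim> x)"
    and neg_monotone_k: "\<lbrakk>x \<in> carrier B; y \<in> carrier B; le_of (kmeet B) x y\<rbrakk>
      \<Longrightarrow> le_of (kmeet B) (\<sim> x) (\<sim> y)"
    and neg_neg: "x \<in> carrier B \<Longrightarrow> \<sim> (\<sim> x) = x"

locale implicative_bilattice = bilattice B for B (structure) +
  assumes impl_closed: "\<lbrakk>x \<in> carrier B; y \<in> carrier B\<rbrakk> \<Longrightarrow> x \<sqsupset> y \<in> carrier B"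
    and IB1: "\<lbrakk>x \<in> carrier B; y \<in> carrier B\<rbrakk> \<Longrightarrow> (x \<sqsupset> x) \<sqsupset> y = y"
    and IB2_t: "\<lbrakk>x \<in> carrier B; y \<in> carrier B; z \<in> carrier B\<rbrakk>
      \<Longrightarrow> x \<sqsupset> (y \<sqsupset> z) = (x \<curlywedge> y) \<sqsupset> z"
    and IB2_k: "\<lbrakk>x \<in> carrier B; y \<in> carrier B; z \<in> carrier B\<rbrakk>
      \<Longrightarrow> (x \<curlywedge> y) \<sqsupset> z = (x \<otimes> y) \<sqsupset> z"
    and IB3: "\<lbrakk>x \<in> carrier B; y \<in> carrier B\<rbrakk>
      \<Longrightarrow> ((x \<sqsupset> y) \<sqsupset> x) \<sqsupset> x = x \<sqsupset> x"
    and IB4_t: "\<lbrakk>x \<in> carrier B; y \<in> carrier B; z \<in> carrier B\<rbrakk>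
      \<Longrightarrow> (x \<curlyvee> y) \<sqsupset> z = (x \<sqsupset> z) \<curlywedge> (y \<sqsupset> z)"
    and IB4_k: "\<lbrakk>x \<in> carrier B; y \<in> carrier B; z \<in> carrier B\<rbrakk>
      \<Longrightarrow> (x \<sqsupset> z) \<curlywedge> (y \<sqsupset> z) = (x \<oplus> y) \<sqsupset> z"
    and IB5: "\<lbrakk>x \<in> carrier B; y \<in> carrier B\<rbrakk>
      \<Longrightarrow> x \<curlywedge> ((x \<sqsupset> y) \<sqsupset> (x \<otimes> y)) = x"
    and IB6: "\<lbrakk>x \<in> carrier B; y \<in> carrier B; z \<in> carrier B\<rbrakk>
      \<Longrightarrow> (\<sim> (x \<sqsupset> y)) \<sqsupset> z = (x \<curlywedge> (\<sim> y)) \<sqsupset> z"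

definition alg_isomorphic :: "'a implicative_alg \<Rightarrow> 'b implicative_alg \<Rightarrow> bool" where
  "alg_isomorphic A B \<longleftrightarrow> (\<exists>f. bij_betw f (carrier A) (carrier B) \<and>
     (\<forall>x\<in>carrier A. \<forall>y\<in>carrier A.
        f (x \<curlywedge>\<^bsub>A\<^esub> y) = f x \<curlywedge>\<^bsub>B\<^esub> f y \<and>
        f (x \<curlyvee>\<^bsub>A\<^esub> y) = f x \<curlyvee>\<^bsub>B\<^esub> f y \<and>
        f (x \<otimes>\<^bsub>A\<^esub> y) = f x \<otimes>\<^bsub>B\<^esub> f y \<and>
        f (x \<oplus>\<^bsub>A\<^esub> y) = f x \<oplus>\<^bsub>B\<^esub> f y \<and>
        f (x \<sqsupset>\<^bsub>A\<^esub> y) = f x \<sqsupset>\<^bsub>B\<^esub> f y) \<and>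
     (\<forall>x\<in>carrier A. f (\<sim>\<^bsub>A\<^esub> x) = \<sim>\<^bsub>B\<^esub> (f x)))"


section \<open>Classical implicative lattices\<close>

record 'a cil_alg = "'a partial_object" +
  lmeet :: "'a \<Rightarrow> 'a \<Rightarrow> 'a" (infixl \<open>\<sqinter>\<index>\<close> 70)
  ljoin :: "'a \<Rightarrow> 'a \<Rightarrow> 'a" (infixl \<open>\<squnion>\<index>\<close> 65)
  ldiff :: "'a \<Rightarrow> 'a \<Rightarrow> 'a" (infixl \<open>\<setminus>\<index>\<close> 75)
  lone :: 'a (\<open>\<one>\<index>\<close>)

text \<open>\<open>rel_complement L u v a c\<close>: the element \<open>c\<close> is a complement of \<open>a\<close> in the
  interval from \<open>u\<close> to \<open>v\<close>.\<close>

definition rel_complement :: "('a, 'm) cil_alg_scheme \<Rightarrow> 'a \<Rightarrow> 'a \<Rightarrow> 'a \<Rightarrow> 'a \<Rightarrow> bool" where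
  "rel_complement L u v a c \<longleftrightarrow> c \<in> carrier L \<and>
     le_of (lmeet L) u c \<and> le_of (lmeet L) c v \<and>
     a \<sqinter>\<^bsub>L\<^esub> c = u \<and> a \<squnion>\<^bsub>L\<^esub> c = v"

text \<open>The assumption on \<open>\<setminus>\<close> determines it on the carrier, since relative
  complements in a distributive lattice are unique.\<close>

locale classical_implicative_lattice =
  lattice_on "carrier L" "lmeet L" "ljoin L" for L (structure) +
  assumes distrib: "\<lbrakk>x \<in> carrier L; y \<in> carrier L; z \<in> carrier L\<rbrakk>
      \<Longrightarrow> x \<sqinter> (y \<squnion> z) = (x \<sqinter> y) \<squnion> (x \<sqinter> z)"
    and relatively_complemented:
      "\<lbrakk>u \<in> carrier L; v \<in> carrier L; a \<in> carrier L;
        le_of (lmeet L) u a; le_of (lmeet L) a v\<rbrakk> \<Longrightarrow> \<exists>c. rel_complement L u v a c"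
    and one_closed: "\<one> \<in> carrier L"
    and one_greatest: "x \<in> carrier L \<Longrightarrow> le_of (lmeet L) x \<one>"
    and diff_rel_complement: "\<lbrakk>a \<in> carrier L; b \<in> carrier L\<rbrakk>
      \<Longrightarrow> rel_complement L (a \<sqinter> b) \<one> a (a \<setminus> b)"


section \<open>Product bilattices\<close>

definition prod_bilattice :: "('a, 'm) cil_alg_scheme \<Rightarrow> ('a \<times> 'a) bilattice_alg" where
  "prod_bilattice L =
    \<lparr>carrier = carrier L \<times> carrier L,
     tmeet = (\<lambda>(a1, a2) (b1, b2). (a1 \<sqinter>\<^bsub>L\<^esub> b1, a2 \<squnion>\<^bsub>L\<^esub> b2)),
     tjoin = (\<lambda>(a1, a2) (b1, b2). (a1 \<squnion>\<^bsub>L\<^esub> b1, a2 \<sqinter>\<^bsub>L\<^esub> b2)),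
     kmeet = (\<lambda>(a1, a2) (b1, b2). (a1 \<sqinter>\<^bsub>L\<^esub> b1, a2 \<sqinter>\<^bsub>L\<^esub> b2)),
     kjoin = (\<lambda>(a1, a2) (b1, b2). (a1 \<squnion>\<^bsub>L\<^esub> b1, a2 \<squnion>\<^bsub>L\<^esub> b2)),
     neg = (\<lambda>(a1, a2). (a2, a1))\<rparr>"

definition prod_implicative :: "('a, 'm) cil_alg_scheme \<Rightarrow> ('a \<times> 'a) implicative_alg" where
  "prod_implicative L = bilattice_alg.extend (prod_bilattice L)
    (implicative_alg.fields (\<lambda>(a1, a2) (b1, b2). (a1 \<setminus>\<^bsub>L\<^esub> b1, a1 \<sqinter>\<^bsub>L\<^esub> b2)))"

lemma prod_implicative_simps [simp]:
  "carrier (prod_implicative L) = carrier L \<times> carrier L"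
  "tmeet (prod_implicative L) (a1, a2) (b1, b2) = (a1 \<sqinter>\<^bsub>L\<^esub> b1, a2 \<squnion>\<^bsub>L\<^esub> b2)"
  "tjoin (prod_implicative L) (a1, a2) (b1, b2) = (a1 \<squnion>\<^bsub>L\<^esub> b1, a2 \<sqinter>\<^bsub>L\<^esub> b2)"
  "kmeet (prod_implicative L) (a1, a2) (b1, b2) = (a1 \<sqinter>\<^bsub>L\<^esub> b1, a2 \<sqinter>\<^bsub>L\<^esub> b2)"
  "kjoin (prod_implicative L) (a1, a2) (b1, b2) = (a1 \<squnion>\<^bsub>L\<^esub> b1, a2 \<squnion>\<^bsub>L\<^esub> b2)"
  "neg (prod_implicative L) (a1, a2) = (a2, a1)"
  "impl (prod_implicative L) (a1, a2) (b1, b2) = (a1 \<setminus>\<^bsub>L\<^esub> b1, a1 \<sqinter>\<^bsub>L\<^esub> b2)"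
  by (simp_all add: prod_implicative_def prod_bilattice_def
      bilattice_alg.defs implicative_alg.defs)

end

theory Submission imports Defs begin

text \<open>Write \<open>x \<preceq> y\<close> when \<open>d = x \<sqsupset> y\<close> is designated, i.e. \<open>d = d \<sqsupset> d\<close>. By (IB1)--(IB4) this
  is a preorder whose quotient is a lattice with implication, in which \<open>\<curlywedge>\<close>, \<open>\<otimes>\<close> become the same
  meet and \<open>\<curlyvee>\<close>, \<open>\<oplus>\<close> the same join; the Peirce law (IB3) makes it a classical implicative lattice.
  By (IB5), \<open>x \<preceq> y\<close> gives \<open>x \<le>\<^sub>t x \<otimes> y\<close>, so \<open>x \<preceq> y\<close> and \<open>\<sim> y \<preceq> \<sim> x\<close> together give \<open>x \<le>\<^sub>t y\<close>.
  Hence \<open>x\<close> is determined by the classes of \<open>x\<close> and \<open>\<sim> x\<close>, and \<open>x \<mapsto> ([x], [\<sim> x])\<close> is the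
  isomorphism; (IB6) says that it respects \<open>\<sqsupset>\<close> in the second component. Every class contains exactly
  one regular element (one with \<open>\<sim> x = x\<close>), so the quotient is realised inside \<open>B\<close> by the
  regular elements with \<open>\<otimes>\<close> and \<open>\<oplus>\<close>.\<close>

section \<open>Order-theoretic facts about lattices given by operations\<close>

context lattice_on
begin

lemma meet_idem: "x \<in> A \<Longrightarrow> m x x = x"
  by (metis join_meet_absorb meet_closed meet_join_absorb)

lemma le_iff_join: "\<lbrakk>x \<in> A; y \<in> A\<rbrakk> \<Longrightarrow> le_of m x y \<longleftrightarrow> j x y = y"
  unfolding le_of_def
  by (metis join_comm join_meet_absorb meet_comm meet_join_absorb)

lemma le_refl: "x \<in> A \<Longrightarrow> le_of m x x"
  by (simp add: le_of_def meet_idem)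

lemma le_antisym: "\<lbrakk>x \<in> A; y \<in> A; le_of m x y; le_of m y x\<rbrakk> \<Longrightarrow> x = y"
  unfolding le_of_def by (metis meet_comm)

lemma le_trans: "\<lbrakk>x \<in> A; y \<in> A; z \<in> A; le_of m x y; le_of m y z\<rbrakk> \<Longrightarrow> le_of m x z"
  unfolding le_of_def by (metis meet_assoc)

lemma meet_le1: "\<lbrakk>x \<in> A; y \<in> A\<rbrakk> \<Longrightarrow> le_of m (m x y) x"
  unfolding le_of_def by (metis meet_assoc meet_comm meet_idem)

lemma meet_le2: "\<lbrakk>x \<in> A; y \<in> A\<rbrakk> \<Longrightarrow> le_of m (m x y) y"
  by (metis meet_le1 meet_comm)

lemma le_join1: "\<lbrakk>x \<in> A; y \<in> A\<rbrakk> \<Longrightarrow> le_of m x (j x y)"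
  by (simp add: le_of_def meet_join_absorb)

lemma le_join2: "\<lbrakk>x \<in> A; y \<in> A\<rbrakk> \<Longrightarrow> le_of m y (j x y)"
  by (metis le_join1 join_comm)

lemma le_meet: "\<lbrakk>x \<in> A; y \<in> A; z \<in> A; le_of m z x; le_of m z y\<rbrakk> \<Longrightarrow> le_of m z (m x y)"
  unfolding le_of_def by (metis meet_assoc)

lemma join_le: "\<lbrakk>x \<in> A; y \<in> A; z \<in> A; le_of m x z; le_of m y z\<rbrakk> \<Longrightarrow> le_of m (j x y) z"
  by (metis le_iff_join join_assoc join_closed)

text \<open>Universal property of the meet. With its dual it turns the order conditions on
  \<open>\<sim>\<close> into De Morgan equations.\<close>

lemma meet_eqI:
  assumes "x \<in> A" "y \<in> A" "w \<in> A" "le_of m w x" "le_of m w y"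
    and "\<And>z. \<lbrakk>z \<in> A; le_of m z x; le_of m z y\<rbrakk> \<Longrightarrow> le_of m z w"
  shows "w = m x y"
  using assms by (meson le_antisym le_meet meet_closed meet_le1 meet_le2)

lemma join_eqI:
  assumes "x \<in> A" "y \<in> A" "w \<in> A" "le_of m x w" "le_of m y w"
    and "\<And>z. \<lbrakk>z \<in> A; le_of m x z; le_of m y z\<rbrakk> \<Longrightarrow> le_of m w z"
  shows "w = j x y"
  using assms by (meson le_antisym join_le join_closed le_join1 le_join2)

end

section \<open>De Morgan laws for negation\<close>

context bilattice
begin

text \<open>Being involutive, \<open>\<sim>\<close> is an anti-automorphism of the truth order, so
  it exchanges meets and joins; for the knowledge order it is an automorphism.\<close>

lemma neg_tmeet:
  assumes "x \<in> carrier B" "y \<in> carrier B"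
  shows "\<sim> (x \<curlywedge> y) = (\<sim> x) \<curlyvee> (\<sim> y)"
proof (rule t.join_eqI)
  fix z assume z: "z \<in> carrier B" "le_of (tmeet B) (\<sim> x) z" "le_of (tmeet B) (\<sim> y) z"
  have "le_of (tmeet B) (\<sim> z) x" "le_of (tmeet B) (\<sim> z) y"
    using z assms neg_antitone_t neg_closed neg_neg by metis+
  then have "le_of (tmeet B) (\<sim> z) (x \<curlywedge> y)"
    using assms z by (simp add: t.le_meet neg_closed)
  then show "le_of (tmeet B) (\<sim> (x \<curlywedge> y)) z"
    using z assms neg_antitone_t neg_closed neg_neg t.meet_closed by metis
qed (use assms in \<open>auto intro!: neg_closed neg_antitone_t t.meet_closed t.meet_le1 t.meet_le2\<close>)

lemma neg_tjoin:
  assumes "x \<in> carrier B" "y \<in> carrier B"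
  shows "\<sim> (x \<curlyvee> y) = (\<sim> x) \<curlywedge> (\<sim> y)"
  using assms neg_tmeet[of "\<sim> x" "\<sim> y"] by (metis neg_closed neg_neg t.meet_closed)

lemma neg_kmeet:
  assumes "x \<in> carrier B" "y \<in> carrier B"
  shows "\<sim> (x \<otimes> y) = (\<sim> x) \<otimes> (\<sim> y)"
proof (rule k.meet_eqI)
  fix z assume z: "z \<in> carrier B" "le_of (kmeet B) z (\<sim> x)" "le_of (kmeet B) z (\<sim> y)"
  have "le_of (kmeet B) (\<sim> z) x" "le_of (kmeet B) (\<sim> z) y"
    using z assms neg_monotone_k neg_closed neg_neg by metis+
  then have "le_of (kmeet B) (\<sim> z) (x \<otimes> y)"
    using assms z by (simp add: k.le_meet neg_closed)
  then show "le_of (kmeet B) z (\<sim> (x \<otimes> y))"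
    using z assms neg_monotone_k neg_closed neg_neg k.meet_closed by metis
qed (use assms in \<open>auto intro!: neg_closed neg_monotone_k k.meet_closed k.meet_le1 k.meet_le2\<close>)

lemma neg_kjoin:
  assumes "x \<in> carrier B" "y \<in> carrier B"
  shows "\<sim> (x \<oplus> y) = (\<sim> x) \<oplus> (\<sim> y)"
proof (rule k.join_eqI)
  fix z assume z: "z \<in> carrier B" "le_of (kmeet B) (\<sim> x) z" "le_of (kmeet B) (\<sim> y) z"
  have "le_of (kmeet B) x (\<sim> z)" "le_of (kmeet B) y (\<sim> z)"
    using z assms neg_monotone_k neg_closed neg_neg by metis+
  then have "le_of (kmeet B) (x \<oplus> y) (\<sim> z)"
    using assms z by (simp add: k.join_le neg_closed)
  then show "le_of (kmeet B) (\<sim> (x \<oplus> y)) z"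
    using z assms neg_monotone_k neg_closed neg_neg k.join_closed by metis
qed (use assms in \<open>auto intro!: neg_closed neg_monotone_k k.join_closed k.le_join1 k.le_join2\<close>)

end

section \<open>The implication preorder\<close>

context implicative_bilattice
begin

lemmas closed [simp] = t.meet_closed t.join_closed k.meet_closed k.join_closed
  neg_closed impl_closed

text \<open>In a product bilattice the designated elements are the pairs with first component
  \<open>\<one>\<close>. Accordingly \<open>\<preceq>\<close> compares first components there, and
  \<open>\<approx>\<close> is equality of first components.\<close>

definition designated :: "'a \<Rightarrow> bool" where
  "designated x \<longleftrightarrow> x \<sqsupset> x = x"

definition entails :: "'a \<Rightarrow> 'a \<Rightarrow> bool" (infix \<open>\<preceq>\<close> 50) where
  "x \<preceq> y \<longleftrightarrow> designated (x \<sqsupset> y)"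

definition interderivable :: "'a \<Rightarrow> 'a \<Rightarrow> bool" (infix \<open>\<approx>\<close> 50) where
  "x \<approx> y \<longleftrightarrow> x \<preceq> y \<and> y \<preceq> x"

lemma designated_impl: "\<lbrakk>designated x; x \<in> carrier B; y \<in> carrier B\<rbrakk> \<Longrightarrow> x \<sqsupset> y = y"
  unfolding designated_def by (metis IB1)

lemma designatedI: "(\<And>y. y \<in> carrier B \<Longrightarrow> x \<sqsupset> y = y) \<Longrightarrow> x \<in> carrier B \<Longrightarrow> designated x"
  unfolding designated_def by simp

lemma designated_refl: "x \<in> carrier B \<Longrightarrow> designated (x \<sqsupset> x)"
  by (simp add: designated_def IB1)

lemma exchange:
  "\<lbrakk>x \<in> carrier B; y \<in> carrier B; z \<in> carrier B\<rbrakk> \<Longrightarrow> x \<sqsupset> y \<sqsupset> z = y \<sqsupset> x \<sqsupset> z"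
  by (simp add: IB2_t t.meet_comm)

lemma contraction: "\<lbrakk>x \<in> carrier B; z \<in> carrier B\<rbrakk> \<Longrightarrow> x \<sqsupset> x \<sqsupset> z = x \<sqsupset> z"
  by (simp add: IB2_t t.meet_idem)

lemma impl_antitone_t:
  assumes "x \<in> carrier B" "y \<in> carrier B" "z \<in> carrier B" "le_of (tmeet B) x y"
  shows "le_of (tmeet B) (y \<sqsupset> z) (x \<sqsupset> z)"
proof -
  have "x \<curlyvee> y = y" using assms t.le_iff_join by blast
  then have "y \<sqsupset> z = (x \<sqsupset> z) \<curlywedge> (y \<sqsupset> z)" using IB4_t assms by metis
  then show ?thesis using assms by (metis t.meet_le1 impl_closed)
qed

lemma le_impl:
  assumes "w \<in> carrier B" "y \<in> carrier B"
  shows "le_of (tmeet B) w (y \<sqsupset> w)"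
proof -
  \<comment> \<open>By (IB1), \<open>?e\<close> is a left identity of \<open>\<sqsupset>\<close>, so
    \<open>w = ?e \<sqsupset> w\<close> and, by (IB2),
    \<open>y \<sqsupset> w = (y \<curlywedge> ?e) \<sqsupset> w\<close>. The claim becomes
    antitonicity in the first argument.\<close>
  let ?e = "w \<sqsupset> w"
  have "le_of (tmeet B) (?e \<sqsupset> w) ((y \<curlywedge> ?e) \<sqsupset> w)"
    using assms by (intro impl_antitone_t) (auto intro: t.meet_le2)
  then show ?thesis using assms by (simp add: IB1 IB2_t[symmetric])
qed

text \<open>Antitonicity gives \<open>y \<sqsupset> z \<le>\<^sub>t x \<sqsupset> z = z\<close>, and
  \<open>le_impl\<close> gives the converse inequality, so \<open>y\<close> is a left identity as
  well.\<close>

lemma designated_upward_t: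
  assumes "designated x" "x \<in> carrier B" "y \<in> carrier B" "le_of (tmeet B) x y"
  shows "designated y"
proof (rule designatedI)
  fix z assume z: "z \<in> carrier B"
  have "le_of (tmeet B) (y \<sqsupset> z) z"
    using impl_antitone_t[OF assms(2,3) z assms(4)] assms z by (simp add: designated_impl)
  then show "y \<sqsupset> z = z" using le_impl[OF z assms(3)] assms z by (simp add: t.le_antisym)
qed fact

lemma designated_tmeet:
  "\<lbrakk>designated x; designated y; x \<in> carrier B; y \<in> carrier B\<rbrakk> \<Longrightarrow> designated (x \<curlywedge> y)"
  by (rule designatedI) (simp_all flip: IB2_t add: designated_impl)

lemma designated_impl_designated:
  "\<lbrakk>designated y; x \<in> carrier B; y \<in> carrier B\<rbrakk> \<Longrightarrow> designated (x \<sqsupset> y)"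
  by (metis designated_upward_t impl_closed le_impl)

lemma entails_refl [simp]: "x \<in> carrier B \<Longrightarrow> x \<preceq> x"
  by (simp add: entails_def designated_refl)

lemma tmeet_entails2: "\<lbrakk>x \<in> carrier B; y \<in> carrier B\<rbrakk> \<Longrightarrow> x \<curlywedge> y \<preceq> y"
  by (simp add: entails_def IB2_t[symmetric] designated_impl_designated designated_refl)

lemma tmeet_entails1: "\<lbrakk>x \<in> carrier B; y \<in> carrier B\<rbrakk> \<Longrightarrow> x \<curlywedge> y \<preceq> x"
  by (metis tmeet_entails2 t.meet_comm)

lemma le_t_entails: "\<lbrakk>x \<in> carrier B; y \<in> carrier B; le_of (tmeet B) x y\<rbrakk> \<Longrightarrow> x \<preceq> y"
  unfolding le_of_def by (metis tmeet_entails2)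

lemma entails_le_kmeet:
  "\<lbrakk>x \<preceq> y; x \<in> carrier B; y \<in> carrier B\<rbrakk> \<Longrightarrow> le_of (tmeet B) x (x \<otimes> y)"
  unfolding le_of_def entails_def using IB5[of x y] by (simp add: designated_impl)

text \<open>Strengthens \<open>impl_antitone_t\<close> from the truth order to
  \<open>\<preceq>\<close>. The link is \<open>x \<otimes> y\<close>: it lies truth-above
  \<open>x\<close> by (IB5), and \<open>(x \<otimes> y) \<sqsupset> z\<close> unfolds to
  \<open>x \<sqsupset> y \<sqsupset> z\<close>, which lies above
  \<open>y \<sqsupset> z\<close>.\<close>

lemma impl_antitone:
  assumes "x \<preceq> y" "x \<in> carrier B" "y \<in> carrier B" "z \<in> carrier B"
  shows "le_of (tmeet B) (y \<sqsupset> z) (x \<sqsupset> z)"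
proof -
  have "le_of (tmeet B) ((x \<otimes> y) \<sqsupset> z) (x \<sqsupset> z)"
    using assms by (simp add: impl_antitone_t entails_le_kmeet)
  then have "le_of (tmeet B) (x \<sqsupset> y \<sqsupset> z) (x \<sqsupset> z)"
    using assms by (simp add: IB2_t IB2_k)
  moreover have "le_of (tmeet B) (y \<sqsupset> z) (x \<sqsupset> y \<sqsupset> z)"
    using assms by (simp add: le_impl)
  ultimately show ?thesis using assms by (meson t.le_trans impl_closed)
qed

lemma entails_trans [trans]:
  "\<lbrakk>x \<preceq> y; y \<preceq> z; x \<in> carrier B; y \<in> carrier B; z \<in> carrier B\<rbrakk> \<Longrightarrow> x \<preceq> z"
  by (meson designated_upward_t entails_def impl_antitone impl_closed)

lemma residuation:
  "\<lbrakk>x \<in> carrier B; y \<in> carrier B; z \<in> carrier B\<rbrakk> \<Longrightarrow> x \<preceq> y \<sqsupset> z \<longleftrightarrow> x \<curlywedge> y \<preceq> z"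
  by (simp add: entails_def IB2_t)

lemma entails_tmeet:
  assumes "z \<preceq> x" "z \<preceq> y" "x \<in> carrier B" "y \<in> carrier B" "z \<in> carrier B"
  shows "z \<preceq> x \<curlywedge> y"
proof -
  \<comment> \<open>Curried pairing: replace \<open>x\<close> by \<open>z\<close>, exchange the
    arguments, replace \<open>y\<close> by \<open>z\<close>, then contract the repeated
    \<open>z\<close>.\<close>
  have "x \<preceq> y \<sqsupset> (x \<curlywedge> y)" using assms by (simp add: residuation)
  then have "z \<preceq> y \<sqsupset> (x \<curlywedge> y)" using assms entails_trans by (meson closed)
  then have "y \<preceq> z \<sqsupset> (x \<curlywedge> y)" using assms by (simp add: entails_def exchange)
  then have "z \<preceq> z \<sqsupset> (x \<curlywedge> y)" using assms entails_trans by (meson closed)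
  then show ?thesis using assms by (simp add: entails_def contraction)
qed

lemma tjoin_entails:
  "\<lbrakk>x \<preceq> z; y \<preceq> z; x \<in> carrier B; y \<in> carrier B; z \<in> carrier B\<rbrakk> \<Longrightarrow> x \<curlyvee> y \<preceq> z"
  by (simp add: entails_def IB4_t designated_tmeet)

lemma entails_tjoin1: "\<lbrakk>x \<in> carrier B; y \<in> carrier B\<rbrakk> \<Longrightarrow> x \<preceq> x \<curlyvee> y"
  by (simp add: le_t_entails t.le_join1)

lemma entails_tjoin2: "\<lbrakk>x \<in> carrier B; y \<in> carrier B\<rbrakk> \<Longrightarrow> y \<preceq> x \<curlyvee> y"
  by (simp add: le_t_entails t.le_join2)

text \<open>By (IB2) both elements have the same implications \<open>_ \<sqsupset> z\<close>; taking
  each of the two for \<open>z\<close> gives the two entailments.\<close>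

lemma kmeet_eq_tmeet: "\<lbrakk>x \<in> carrier B; y \<in> carrier B\<rbrakk> \<Longrightarrow> x \<otimes> y \<approx> x \<curlywedge> y"
  by (metis interderivable_def IB2_k entails_def designated_refl closed(1,3))

lemma kjoin_eq_tjoin: "\<lbrakk>x \<in> carrier B; y \<in> carrier B\<rbrakk> \<Longrightarrow> x \<oplus> y \<approx> x \<curlyvee> y"
  by (metis interderivable_def IB4_k IB4_t entails_def designated_refl closed(2,4))

lemma kmeet_entails1: "\<lbrakk>x \<in> carrier B; y \<in> carrier B\<rbrakk> \<Longrightarrow> x \<otimes> y \<preceq> x"
  and kmeet_entails2: "\<lbrakk>x \<in> carrier B; y \<in> carrier B\<rbrakk> \<Longrightarrow> x \<otimes> y \<preceq> y"
  and entails_kjoin1: "\<lbrakk>x \<in> carrier B; y \<in> carrier B\<rbrakk> \<Longrightarrow> x \<preceq> x \<oplus> y"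
  and entails_kjoin2: "\<lbrakk>x \<in> carrier B; y \<in> carrier B\<rbrakk> \<Longrightarrow> y \<preceq> x \<oplus> y"
  using kmeet_eq_tmeet kjoin_eq_tjoin tmeet_entails1 tmeet_entails2 entails_tjoin1 entails_tjoin2
    entails_trans closed unfolding interderivable_def by meson+

lemma entails_kmeet:
  "\<lbrakk>z \<preceq> x; z \<preceq> y; x \<in> carrier B; y \<in> carrier B; z \<in> carrier B\<rbrakk> \<Longrightarrow> z \<preceq> x \<otimes> y"
  using kmeet_eq_tmeet entails_tmeet entails_trans closed unfolding interderivable_def by meson

lemma kjoin_entails:
  "\<lbrakk>x \<preceq> z; y \<preceq> z; x \<in> carrier B; y \<in> carrier B; z \<in> carrier B\<rbrakk> \<Longrightarrow> x \<oplus> y \<preceq> z"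
  using kjoin_eq_tjoin tjoin_entails entails_trans closed unfolding interderivable_def by meson

lemma modus_ponens: "\<lbrakk>x \<in> carrier B; y \<in> carrier B\<rbrakk> \<Longrightarrow> x \<curlywedge> (x \<sqsupset> y) \<preceq> y"
  using residuation[of "x \<sqsupset> y" x y] by (simp add: t.meet_comm)

lemma impl_mono:
  assumes "x' \<preceq> x" "y \<preceq> y'" "x \<in> carrier B" "x' \<in> carrier B" "y \<in> carrier B" "y' \<in> carrier B"
  shows "x \<sqsupset> y \<preceq> x' \<sqsupset> y'"
proof -
  have "(x \<sqsupset> y) \<curlywedge> x' \<preceq> x \<curlywedge> (x \<sqsupset> y)"
    using assms by (meson entails_tmeet tmeet_entails1 tmeet_entails2 entails_trans closed)
  also have "\<dots> \<preceq> y" using assms by (simp add: modus_ponens)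
  also have "y \<preceq> y'" by fact
  finally show ?thesis using assms by (simp add: residuation)
qed

lemma excluded_middle:
  assumes "x \<in> carrier B" "y \<in> carrier B"
  shows "designated (x \<curlyvee> (x \<sqsupset> y))"
proof -
  let ?p = "x \<curlyvee> (x \<sqsupset> y)"
  have "?p \<sqsupset> y \<preceq> x \<sqsupset> y"
    using assms by (intro impl_mono) (auto intro: entails_tjoin1)
  also have "\<dots> \<preceq> ?p" using assms by (simp add: entails_tjoin2)
  finally have "designated ((?p \<sqsupset> y) \<sqsupset> ?p)" using assms by (simp add: entails_def)
  \<comment> \<open>The premise of Peirce's law is designated, so the left side of (IB3) collapses
    to \<open>?p\<close>, leaving \<open>?p = ?p \<sqsupset> ?p\<close>.\<close>
  then show ?thesis
    using assms IB3[of ?p y] designated_impl[of "(?p \<sqsupset> y) \<sqsupset> ?p" ?p]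
    by (metis closed(2,6) designated_def)
qed

lemma neg_impl: "\<lbrakk>x \<in> carrier B; y \<in> carrier B\<rbrakk> \<Longrightarrow> \<sim> (x \<sqsupset> y) \<approx> x \<curlywedge> (\<sim> y)"
  by (metis interderivable_def IB6 entails_def designated_refl closed)

section \<open>Compatibility of interderivability with \<otimes>, \<oplus> and \<sqsupset>\<close>

lemma interderivable_refl: "x \<in> carrier B \<Longrightarrow> x \<approx> x"
  by (simp add: interderivable_def)

lemma interderivable_sym: "x \<approx> y \<Longrightarrow> y \<approx> x"
  by (simp add: interderivable_def)

lemma interderivable_trans [trans]:
  "\<lbrakk>x \<approx> y; y \<approx> z; x \<in> carrier B; y \<in> carrier B; z \<in> carrier B\<rbrakk> \<Longrightarrow> x \<approx> z"
  by (meson entails_trans interderivable_def)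

lemma tmeet_mono:
  "\<lbrakk>x \<preceq> x'; y \<preceq> y'; x \<in> carrier B; x' \<in> carrier B; y \<in> carrier B; y' \<in> carrier B\<rbrakk>
    \<Longrightarrow> x \<curlywedge> y \<preceq> x' \<curlywedge> y'"
  by (meson entails_tmeet tmeet_entails1 tmeet_entails2 entails_trans closed)

lemma kmeet_mono:
  "\<lbrakk>x \<preceq> x'; y \<preceq> y'; x \<in> carrier B; x' \<in> carrier B; y \<in> carrier B; y' \<in> carrier B\<rbrakk>
    \<Longrightarrow> x \<otimes> y \<preceq> x' \<otimes> y'"
  by (meson entails_kmeet kmeet_entails1 kmeet_entails2 entails_trans closed)

lemma kjoin_mono:
  "\<lbrakk>x \<preceq> x'; y \<preceq> y'; x \<in> carrier B; x' \<in> carrier B; y \<in> carrier B; y' \<in> carrier B\<rbrakk>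
    \<Longrightarrow> x \<oplus> y \<preceq> x' \<oplus> y'"
  by (meson kjoin_entails entails_kjoin1 entails_kjoin2 entails_trans closed)

lemma interderivable_kmeet:
  "\<lbrakk>x \<approx> x'; y \<approx> y'; x \<in> carrier B; x' \<in> carrier B; y \<in> carrier B; y' \<in> carrier B\<rbrakk>
    \<Longrightarrow> x \<otimes> y \<approx> x' \<otimes> y'"
  by (simp add: interderivable_def kmeet_mono)

lemma interderivable_kjoin:
  "\<lbrakk>x \<approx> x'; y \<approx> y'; x \<in> carrier B; x' \<in> carrier B; y \<in> carrier B; y' \<in> carrier B\<rbrakk>
    \<Longrightarrow> x \<oplus> y \<approx> x' \<oplus> y'"
  by (simp add: interderivable_def kjoin_mono)

lemma interderivable_impl:
  "\<lbrakk>x \<approx> x'; y \<approx> y'; x \<in> carrier B; x' \<in> carrier B; y \<in> carrier B; y' \<in> carrier B\<rbrakk>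
    \<Longrightarrow> x \<sqsupset> y \<approx> x' \<sqsupset> y'"
  by (simp add: interderivable_def impl_mono)

text \<open>The element \<open>y \<otimes> x\<close> interpolates: (IB5) for \<open>x\<close>,
  \<open>y\<close> puts it truth-above \<open>x\<close>, and (IB5) for the negations, pulled back
  along \<open>\<sim>\<close>, puts it truth-below \<open>y\<close>.\<close>

lemma le_tI:
  assumes "x \<preceq> y" "\<sim> y \<preceq> \<sim> x" "x \<in> carrier B" "y \<in> carrier B"
  shows "le_of (tmeet B) x y"
proof -
  have "le_of (tmeet B) (\<sim> y) (\<sim> (y \<otimes> x))"
    using assms entails_le_kmeet[of "\<sim> y" "\<sim> x"] by (simp add: neg_kmeet)
  then have "le_of (tmeet B) (y \<otimes> x) y"
    using neg_antitone_t[of "\<sim> y" "\<sim> (y \<otimes> x)"] assms by (simp add: neg_neg)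
  moreover have "le_of (tmeet B) x (y \<otimes> x)"
    using entails_le_kmeet[of x y] assms by (simp add: k.meet_comm)
  ultimately show ?thesis using assms by (meson t.le_trans closed)
qed

lemma eqI:
  "\<lbrakk>x \<approx> y; \<sim> x \<approx> \<sim> y; x \<in> carrier B; y \<in> carrier B\<rbrakk> \<Longrightarrow> x = y"
  by (simp add: interderivable_def le_tI t.le_antisym)

section \<open>The lattice of regular elements\<close>

text \<open>In a product bilattice these are the diagonal pairs \<open>(a, a)\<close>, a copy of the
  factor on which \<open>\<otimes>\<close> and \<open>\<oplus>\<close> act as its meet and
  join.\<close>

definition regular :: "'a set" where
  "regular = {x \<in> carrier B. \<sim> x = x}"

lemma regularI: "\<lbrakk>x \<in> carrier B; \<sim> x = x\<rbrakk> \<Longrightarrow> x \<in> regular"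
  by (simp add: regular_def)

lemma regular_closed [simp]: "x \<in> regular \<Longrightarrow> x \<in> carrier B"
  by (simp add: regular_def)

lemma regular_neg: "x \<in> regular \<Longrightarrow> \<sim> x = x"
  unfolding regular_def by blast

lemma regular_eqI: "\<lbrakk>x \<approx> y; x \<in> regular; y \<in> regular\<rbrakk> \<Longrightarrow> x = y"
  by (simp add: eqI regular_neg)

lemma regular_kmeet: "\<lbrakk>x \<in> regular; y \<in> regular\<rbrakk> \<Longrightarrow> x \<otimes> y \<in> regular"
  and regular_kjoin: "\<lbrakk>x \<in> regular; y \<in> regular\<rbrakk> \<Longrightarrow> x \<oplus> y \<in> regular"
  by (rule regularI; simp add: neg_kmeet neg_kjoin regular_neg)+

text \<open>In a product bilattice \<open>x = (a, b)\<close> gives \<open>reg x = (a, a)\<close>, through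
  \<open>x \<curlyvee> (x \<otimes> \<sim> x) = (a, a \<sqinter> b)\<close>.\<close>

definition reg :: "'a \<Rightarrow> 'a" where
  "reg x = (x \<curlyvee> (x \<otimes> (\<sim> x))) \<oplus> (\<sim> (x \<curlyvee> (x \<otimes> (\<sim> x))))"

lemma reg_regular [simp]: "x \<in> carrier B \<Longrightarrow> reg x \<in> regular"
  by (rule regularI) (simp_all add: reg_def neg_kjoin neg_neg k.join_comm)

lemma reg_interderivable:
  assumes "x \<in> carrier B"
  shows "reg x \<approx> x"
proof -
  let ?u = "x \<curlyvee> (x \<otimes> (\<sim> x))"
  \<comment> \<open>The second joinand of \<open>reg x\<close> also entails \<open>x\<close>,
    because \<open>x\<close> is a factor of this meet.\<close>
  have "\<sim> ?u = (\<sim> x) \<curlywedge> ((\<sim> x) \<otimes> x)"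
    using assms by (simp add: neg_tjoin neg_kmeet neg_neg)
  moreover have "(\<sim> x) \<curlywedge> ((\<sim> x) \<otimes> x) \<preceq> x"
    using assms by (meson tmeet_entails2 kmeet_entails2 entails_trans closed)
  ultimately have "\<sim> ?u \<preceq> x" by simp
  moreover have "?u \<preceq> x" using assms by (simp add: tjoin_entails kmeet_entails1)
  ultimately have "reg x \<preceq> x" using assms by (simp add: reg_def kjoin_entails)
  moreover have "x \<preceq> reg x" unfolding reg_def
    using assms by (meson entails_tjoin1 entails_kjoin1 entails_trans closed)
  ultimately show ?thesis by (simp add: interderivable_def)
qed

lemma reg_carrier [simp]: "x \<in> carrier B \<Longrightarrow> reg x \<in> carrier B"
  by simp

text \<open>Uniqueness of the regular representative of a class. Equations for \<open>reg\<close>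
  are obtained by exhibiting a regular element in the right class.\<close>

lemma reg_eqI: "\<lbrakk>y \<approx> x; x \<in> carrier B; y \<in> regular\<rbrakk> \<Longrightarrow> reg x = y"
  by (meson interderivable_sym interderivable_trans reg_carrier reg_interderivable reg_regular
      regular_closed regular_eqI)

lemma reg_cong:
  "\<lbrakk>x \<approx> y; x \<in> carrier B; y \<in> carrier B\<rbrakk> \<Longrightarrow> reg x = reg y"
  by (meson interderivable_sym interderivable_trans reg_carrier reg_interderivable reg_regular
      reg_eqI)

lemma interderivable_iff_reg:
  "\<lbrakk>x \<in> carrier B; y \<in> carrier B\<rbrakk> \<Longrightarrow> x \<approx> y \<longleftrightarrow> reg x = reg y"
  by (metis interderivable_sym interderivable_trans reg_carrier reg_interderivable reg_cong)

lemma reg_id: "x \<in> regular \<Longrightarrow> reg x = x"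
  by (simp add: reg_eqI interderivable_refl)

lemma reg_kmeet: "\<lbrakk>x \<in> carrier B; y \<in> carrier B\<rbrakk> \<Longrightarrow> reg (x \<otimes> y) = reg x \<otimes> reg y"
  by (simp add: reg_eqI regular_kmeet interderivable_kmeet reg_interderivable)

lemma reg_kjoin: "\<lbrakk>x \<in> carrier B; y \<in> carrier B\<rbrakk> \<Longrightarrow> reg (x \<oplus> y) = reg x \<oplus> reg y"
  by (simp add: reg_eqI regular_kjoin interderivable_kjoin reg_interderivable)

lemma reg_tmeet: "\<lbrakk>x \<in> carrier B; y \<in> carrier B\<rbrakk> \<Longrightarrow> reg (x \<curlywedge> y) = reg x \<otimes> reg y"
  by (metis closed(1,3) kmeet_eq_tmeet reg_cong reg_kmeet)

lemma reg_tjoin: "\<lbrakk>x \<in> carrier B; y \<in> carrier B\<rbrakk> \<Longrightarrow> reg (x \<curlyvee> y) = reg x \<oplus> reg y"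
  by (metis closed(2,4) kjoin_eq_tjoin reg_cong reg_kjoin)

text \<open>The outer \<open>reg\<close> stays because the implication of two regular elements is in
  general not regular.\<close>

lemma reg_impl: "\<lbrakk>x \<in> carrier B; y \<in> carrier B\<rbrakk> \<Longrightarrow> reg (x \<sqsupset> y) = reg (reg x \<sqsupset> reg y)"
  by (simp add: reg_cong interderivable_impl reg_interderivable interderivable_sym)

text \<open>This is the second coordinate \<open>a1 \<sqinter> b2\<close> of the product
  implication.\<close>

lemma reg_neg_impl:
  "\<lbrakk>x \<in> carrier B; y \<in> carrier B\<rbrakk> \<Longrightarrow> reg (\<sim> (x \<sqsupset> y)) = reg x \<otimes> reg (\<sim> y)"
  by (metis closed(1,5,6) neg_impl reg_cong reg_tmeet)

lemma regular_le_iff: "\<lbrakk>x \<in> regular; y \<in> regular\<rbrakk> \<Longrightarrow> le_of (kmeet B) x y \<longleftrightarrow> x \<preceq> y"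
  unfolding le_of_def
  by (metis entails_kmeet entails_refl interderivable_def kmeet_entails1 kmeet_entails2
      regular_closed regular_eqI regular_kmeet)

text \<open>Every \<open>x \<sqsupset> x\<close> is designated and all designated elements are
  interderivable, so the top does not depend on the choice made by \<open>SOME\<close>.\<close>

definition regular_lattice :: "'a cil_alg" where
  "regular_lattice = \<lparr>carrier = regular, lmeet = kmeet B, ljoin = kjoin B,
     ldiff = (\<lambda>x y. reg (x \<sqsupset> y)),
     lone = reg ((SOME x. x \<in> carrier B) \<sqsupset> (SOME x. x \<in> carrier B))\<rparr>"

lemma regular_lattice_simps [simp]:
  "carrier regular_lattice = regular"
  "lmeet regular_lattice = kmeet B"
  "ljoin regular_lattice = kjoin B"
  "ldiff regular_lattice x y = reg (x \<sqsupset> y)"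
  by (simp_all add: regular_lattice_def)

lemma regular_lattice_one:
  obtains e where "e \<in> carrier B" "designated e" "lone regular_lattice = reg e"
proof
  have "(SOME x. x \<in> carrier B) \<in> carrier B"
    using t.nonempty by (simp add: some_in_eq)
  then show "((SOME x. x \<in> carrier B) \<sqsupset> (SOME x. x \<in> carrier B)) \<in> carrier B"
    "designated ((SOME x. x \<in> carrier B) \<sqsupset> (SOME x. x \<in> carrier B))"
    by (simp_all add: designated_refl)
qed (simp add: regular_lattice_def)

lemma entails_designated:
  "\<lbrakk>designated y; x \<in> carrier B; y \<in> carrier B\<rbrakk> \<Longrightarrow> x \<preceq> y"
  by (simp add: entails_def designated_impl_designated)

text \<open>By residuation, meeting with \<open>x\<close> is left adjoint to
  \<open>x \<sqsupset> _\<close>, hence preserves joins up to \<open>\<approx>\<close>.\<close>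

lemma tmeet_tjoin_distrib:
  assumes "x \<in> carrier B" "y \<in> carrier B" "z \<in> carrier B"
  shows "x \<curlywedge> (y \<curlyvee> z) \<preceq> (x \<curlywedge> y) \<curlyvee> (x \<curlywedge> z)"
proof -
  have "y \<preceq> x \<sqsupset> ((x \<curlywedge> y) \<curlyvee> (x \<curlywedge> z))" "z \<preceq> x \<sqsupset> ((x \<curlywedge> y) \<curlyvee> (x \<curlywedge> z))"
    using assms by (simp_all add: residuation t.meet_comm entails_tjoin1 entails_tjoin2)
  then have "y \<curlyvee> z \<preceq> x \<sqsupset> ((x \<curlywedge> y) \<curlyvee> (x \<curlywedge> z))"
    using assms by (simp add: tjoin_entails)
  then show ?thesis using assms by (simp add: residuation t.meet_comm)
qed

lemma regular_distrib:
  assumes "x \<in> regular" "y \<in> regular" "z \<in> regular"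
  shows "x \<otimes> (y \<oplus> z) = (x \<otimes> y) \<oplus> (x \<otimes> z)"
proof -
  have "x \<curlywedge> (y \<curlyvee> z) \<approx> (x \<curlywedge> y) \<curlyvee> (x \<curlywedge> z)"
    unfolding interderivable_def
  proof
    show "(x \<curlywedge> y) \<curlyvee> (x \<curlywedge> z) \<preceq> x \<curlywedge> (y \<curlyvee> z)"
      using assms by (simp add: tjoin_entails tmeet_mono entails_tjoin1 entails_tjoin2)
  qed (use assms in \<open>simp add: tmeet_tjoin_distrib\<close>)
  then have "reg (x \<curlywedge> (y \<curlyvee> z)) = reg ((x \<curlywedge> y) \<curlyvee> (x \<curlywedge> z))"
    using assms by (simp add: reg_cong)
  then show ?thesis using assms by (simp add: reg_tmeet reg_tjoin reg_id)
qed

text \<open>Images under \<open>reg\<close> of modus ponens and of the excluded middle.\<close>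

lemma regular_diff:
  assumes "a \<in> regular" "b \<in> regular"
  shows "a \<otimes> reg (a \<sqsupset> b) = a \<otimes> b"
    and "a \<oplus> reg (a \<sqsupset> b) = lone regular_lattice"
proof -
  have "a \<curlywedge> (a \<sqsupset> b) \<approx> a \<curlywedge> b"
    unfolding interderivable_def
  proof
    show "a \<curlywedge> (a \<sqsupset> b) \<preceq> a \<curlywedge> b"
      using assms by (simp add: entails_tmeet tmeet_entails1 modus_ponens)
    show "a \<curlywedge> b \<preceq> a \<curlywedge> (a \<sqsupset> b)"
      using assms by (simp add: tmeet_mono le_impl le_t_entails)
  qed
  then have "reg (a \<curlywedge> (a \<sqsupset> b)) = reg (a \<curlywedge> b)"
    using assms by (simp add: reg_cong)
  then show "a \<otimes> reg (a \<sqsupset> b) = a \<otimes> b"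
    using assms by (simp add: reg_tmeet reg_id)
  obtain e where e: "e \<in> carrier B" "designated e" "lone regular_lattice = reg e"
    by (rule regular_lattice_one)
  have "a \<curlyvee> (a \<sqsupset> b) \<approx> e"
    using assms e by (simp add: interderivable_def entails_designated excluded_middle)
  then have "reg (a \<curlyvee> (a \<sqsupset> b)) = reg e"
    using assms e by (simp add: reg_cong)
  then show "a \<oplus> reg (a \<sqsupset> b) = lone regular_lattice"
    using assms e by (simp add: reg_tjoin reg_id)
qed

end

text \<open>Complements in the intervals up to the top suffice; those in arbitrary intervals are
  derived from them.\<close>

lemma classical_implicative_latticeI:
  assumes "lattice_on (carrier L) (lmeet L) (ljoin L)"
    and distrib: "\<And>x y z. \<lbrakk>x \<in> carrier L; y \<in> carrier L; z \<in> carrier L\<rbrakk>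
      \<Longrightarrow> x \<sqinter>\<^bsub>L\<^esub> (y \<squnion>\<^bsub>L\<^esub> z) = (x \<sqinter>\<^bsub>L\<^esub> y) \<squnion>\<^bsub>L\<^esub> (x \<sqinter>\<^bsub>L\<^esub> z)"
    and one: "\<one>\<^bsub>L\<^esub> \<in> carrier L"
    and greatest: "\<And>x. x \<in> carrier L \<Longrightarrow> le_of (lmeet L) x \<one>\<^bsub>L\<^esub>"
    and diff: "\<And>a b. \<lbrakk>a \<in> carrier L; b \<in> carrier L\<rbrakk> \<Longrightarrow> a \<setminus>\<^bsub>L\<^esub> b \<in> carrier L"
      "\<And>a b. \<lbrakk>a \<in> carrier L; b \<in> carrier L\<rbrakk> \<Longrightarrow> a \<sqinter>\<^bsub>L\<^esub> (a \<setminus>\<^bsub>L\<^esub> b) = a \<sqinter>\<^bsub>L\<^esub> b"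
      "\<And>a b. \<lbrakk>a \<in> carrier L; b \<in> carrier L\<rbrakk> \<Longrightarrow> a \<squnion>\<^bsub>L\<^esub> (a \<setminus>\<^bsub>L\<^esub> b) = \<one>\<^bsub>L\<^esub>"
  shows "classical_implicative_lattice L"
proof -
  interpret lattice_on "carrier L" "lmeet L" "ljoin L" by fact
  show ?thesis
  proof
    fix a b assume ab: "a \<in> carrier L" "b \<in> carrier L"
    then show "rel_complement L (a \<sqinter>\<^bsub>L\<^esub> b) \<one>\<^bsub>L\<^esub> a (a \<setminus>\<^bsub>L\<^esub> b)"
      using meet_le2[of a "a \<setminus>\<^bsub>L\<^esub> b"] by (simp add: rel_complement_def diff greatest)
  next
    fix u v a assume h: "u \<in> carrier L" "v \<in> carrier L" "a \<in> carrier L"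
      "le_of (lmeet L) u a" "le_of (lmeet L) a v"
    \<comment> \<open>Since \<open>u\<close> lies below \<open>a\<close>, the first factor is the
      complement of \<open>a\<close> in the interval from \<open>u\<close> to the top; meeting with
      \<open>v\<close> cuts it down to the interval from \<open>u\<close> to
      \<open>v\<close>.\<close>
    let ?c = "a \<setminus>\<^bsub>L\<^esub> u \<sqinter>\<^bsub>L\<^esub> v"
    have c: "a \<setminus>\<^bsub>L\<^esub> u \<in> carrier L" "?c \<in> carrier L"
      using h by (simp_all add: diff meet_closed)
    have 1: "a \<sqinter>\<^bsub>L\<^esub> ?c = u"
    proof -
      have "a \<sqinter>\<^bsub>L\<^esub> ?c = (a \<sqinter>\<^bsub>L\<^esub> u) \<sqinter>\<^bsub>L\<^esub> v"
        using h c diff(2) by (metis meet_assoc)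
      then show ?thesis using h
        by (metis le_of_def meet_comm le_trans)
    qed
    have 2: "a \<squnion>\<^bsub>L\<^esub> ?c = v"
    proof -
      have "a \<squnion>\<^bsub>L\<^esub> ?c = (v \<sqinter>\<^bsub>L\<^esub> a) \<squnion>\<^bsub>L\<^esub> (v \<sqinter>\<^bsub>L\<^esub> (a \<setminus>\<^bsub>L\<^esub> u))"
        using h c by (metis le_of_def meet_comm)
      also have "\<dots> = v \<sqinter>\<^bsub>L\<^esub> \<one>\<^bsub>L\<^esub>"
        using h c by (metis diff(3) distrib)
      finally show ?thesis using h greatest by (simp add: le_of_def)
    qed
    show "\<exists>c. rel_complement L u v a c"
      using 1 2 c h unfolding rel_complement_def
      by (metis meet_le2)
  qed (use assms in auto)
qed

context implicative_bilattice
begin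

lemma regular_lattice_classical: "classical_implicative_lattice regular_lattice"
proof (rule classical_implicative_latticeI)
  obtain e where e: "e \<in> carrier B" "designated e" "lone regular_lattice = reg e"
    by (rule regular_lattice_one)
  show "lattice_on (carrier regular_lattice) (lmeet regular_lattice) (ljoin regular_lattice)"
  proof
    show "carrier regular_lattice \<noteq> {}" using reg_regular[OF e(1)] by auto
  qed (auto intro: regular_kmeet regular_kjoin k.meet_comm k.join_comm k.meet_assoc k.join_assoc
      k.meet_join_absorb k.join_meet_absorb)
  show "lone regular_lattice \<in> carrier regular_lattice" using e by simp
  fix x assume x: "x \<in> carrier regular_lattice"
  have "x \<preceq> reg e"
    using x e entails_designated reg_interderivable
    by (metis entails_trans interderivable_def reg_carrier regular_closed regular_lattice_simps(1))
  then show "le_of (lmeet regular_lattice) x (lone regular_lattice)"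
    using x e by (simp add: regular_le_iff)
qed (auto simp: regular_distrib regular_diff)

text \<open>The preimage of \<open>(a, b)\<close> is found by computing in the product bilattice, where the
  regular elements \<open>a\<close>, \<open>b\<close> stand for \<open>(a, a)\<close>, \<open>(b, b)\<close>: the two joinands are
  \<open>(a, a \<sqinter> b)\<close> and \<open>(a \<sqinter> b, b)\<close>.\<close>

lemma regular_pair:
  assumes "a \<in> regular" "b \<in> regular"
  shows "\<exists>x\<in>carrier B. reg x = a \<and> reg (\<sim> x) = b"
proof
  let ?x = "((a \<curlyvee> b) \<otimes> a) \<oplus> ((a \<curlywedge> b) \<otimes> b)"
  have ab [simp]: "a \<in> carrier B" "b \<in> carrier B" using assms by simp_all
  show x: "?x \<in> carrier B" by simp
  have neg: "\<sim> ?x = ((a \<curlywedge> b) \<otimes> a) \<oplus> ((a \<curlyvee> b) \<otimes> b)"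
    using assms by (simp add: neg_kjoin neg_kmeet neg_tjoin neg_tmeet regular_neg)
  \<comment> \<open>Under \<open>reg\<close> both meets become \<open>\<otimes>\<close> and both
    joins \<open>\<oplus>\<close>, so each coordinate reduces to an absorption in the regular
    lattice.\<close>
  have "(a \<otimes> b) \<otimes> b = b \<otimes> a" "(a \<otimes> b) \<otimes> a = a \<otimes> b" "(a \<oplus> b) \<otimes> a = a" "(a \<oplus> b) \<otimes> b = b"
    by (metis ab k.meet_assoc k.meet_comm k.meet_idem k.join_comm k.join_closed
        k.meet_join_absorb)+
  then show "reg ?x = a \<and> reg (\<sim> ?x) = b"
    unfolding neg using assms
    by (simp add: reg_kjoin reg_kmeet reg_tjoin reg_tmeet reg_id)
      (metis ab k.join_comm k.meet_comm k.join_meet_absorb k.meet_closed)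
qed

lemma pairing_bij:
  "bij_betw (\<lambda>x. (reg x, reg (\<sim> x))) (carrier B) (regular \<times> regular)"
proof (rule bij_betw_imageI)
  show "inj_on (\<lambda>x. (reg x, reg (\<sim> x))) (carrier B)"
    by (rule inj_onI) (auto intro: eqI simp: interderivable_iff_reg)
  show "(\<lambda>x. (reg x, reg (\<sim> x))) ` carrier B = regular \<times> regular"
    using regular_pair by (auto simp: image_iff)
qed

end

lemma regular_lattice_isomorphic:
  fixes B :: "'a implicative_alg"
  assumes "implicative_bilattice B"
  shows "alg_isomorphic B (prod_implicative (implicative_bilattice.regular_lattice B))"
proof -
  interpret implicative_bilattice B by fact
  show ?thesis
    unfolding alg_isomorphic_def
    by (rule exI[of _ "\<lambda>x. (reg x, reg (\<sim>\<^bsub>B\<^esub> x))"])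
      (simp add: pairing_bij reg_tmeet reg_tjoin reg_kmeet reg_kjoin reg_neg_impl neg_tmeet
        neg_tjoin neg_kmeet neg_kjoin neg_neg flip: reg_impl)
qed

section \<open>Products of classical implicative lattices\<close>

context classical_implicative_lattice
begin

lemma diff_closed: "\<lbrakk>a \<in> carrier L; b \<in> carrier L\<rbrakk> \<Longrightarrow> a \<setminus> b \<in> carrier L"
  and meet_diff: "\<lbrakk>a \<in> carrier L; b \<in> carrier L\<rbrakk> \<Longrightarrow> a \<sqinter> (a \<setminus> b) = a \<sqinter> b"
  and join_diff: "\<lbrakk>a \<in> carrier L; b \<in> carrier L\<rbrakk> \<Longrightarrow> a \<squnion> (a \<setminus> b) = \<one>"
  using diff_rel_complement by (auto simp: rel_complement_def)

lemmas closed [simp] = meet_closed join_closed diff_closed one_closed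

text \<open>The relative complement is the residual of the meet. Together with
  \<open>eq_by_lower_bounds\<close> this reduces laws of \<open>\<setminus>\<close> to comparing
  lower bounds.\<close>

lemma le_diff_iff:
  assumes [simp]: "a \<in> carrier L" "b \<in> carrier L" "c \<in> carrier L"
  shows "le_of (lmeet L) c (a \<setminus> b) \<longleftrightarrow> le_of (lmeet L) (c \<sqinter> a) b"
proof
  assume "le_of (lmeet L) c (a \<setminus> b)"
  then have "c \<sqinter> a = c \<sqinter> (a \<sqinter> b)"
    by (metis assms diff_closed le_of_def meet_assoc meet_comm meet_diff)
  then show "le_of (lmeet L) (c \<sqinter> a) b"
    by (simp add: le_of_def meet_assoc meet_idem)
next
  assume h: "le_of (lmeet L) (c \<sqinter> a) b"
  have "c \<sqinter> \<one> = c" using one_greatest[of c] by (simp add: le_of_def)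
  \<comment> \<open>Splits \<open>c\<close> along
    \<open>a \<squnion> (a \<setminus> b) = \<one>\<close>; the first piece lies below
    \<open>a \<setminus> b\<close> through \<open>a \<sqinter> b\<close>.\<close>
  then have c: "c = (c \<sqinter> a) \<squnion> (c \<sqinter> (a \<setminus> b))"
    by (metis assms diff_closed distrib join_diff)
  have "le_of (lmeet L) (c \<sqinter> a) (a \<sqinter> b)"
    using h by (simp add: le_meet meet_le2)
  moreover have "le_of (lmeet L) (a \<sqinter> b) (a \<setminus> b)"
    by (metis assms diff_closed meet_diff meet_le2)
  ultimately have "le_of (lmeet L) (c \<sqinter> a) (a \<setminus> b)"
    by (meson assms closed le_trans)
  then show "le_of (lmeet L) c (a \<setminus> b)"
    by (subst c) (simp add: join_le meet_le2)
qed

lemma eq_by_lower_bounds: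
  assumes "x \<in> carrier L" "y \<in> carrier L"
    and "\<And>z. z \<in> carrier L \<Longrightarrow> le_of (lmeet L) z x \<longleftrightarrow> le_of (lmeet L) z y"
  shows "x = y"
  using assms by (meson le_antisym le_refl)

lemma meet_one: "a \<in> carrier L \<Longrightarrow> a \<sqinter> \<one> = a"
  using one_greatest by (simp add: le_of_def)

lemma one_meet: "a \<in> carrier L \<Longrightarrow> \<one> \<sqinter> a = a"
  by (metis meet_comm meet_one one_closed)

lemma diff_self: "a \<in> carrier L \<Longrightarrow> a \<setminus> a = \<one>"
  by (rule eq_by_lower_bounds) (simp_all add: le_diff_iff meet_le2 one_greatest)

lemma one_diff: "a \<in> carrier L \<Longrightarrow> \<one> \<setminus> a = a"
  by (rule eq_by_lower_bounds) (simp_all add: le_diff_iff meet_one)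

lemma diff_diff:
  "\<lbrakk>a \<in> carrier L; b \<in> carrier L; c \<in> carrier L\<rbrakk> \<Longrightarrow> a \<setminus> (b \<setminus> c) = (a \<sqinter> b) \<setminus> c"
  by (rule eq_by_lower_bounds) (simp_all add: le_diff_iff meet_assoc)

lemma le_meet_iff:
  "\<lbrakk>x \<in> carrier L; y \<in> carrier L; z \<in> carrier L\<rbrakk>
    \<Longrightarrow> le_of (lmeet L) z (x \<sqinter> y) \<longleftrightarrow> le_of (lmeet L) z x \<and> le_of (lmeet L) z y"
  by (meson le_meet le_trans meet_closed meet_le1 meet_le2)

lemma join_le_iff:
  "\<lbrakk>x \<in> carrier L; y \<in> carrier L; z \<in> carrier L\<rbrakk>
    \<Longrightarrow> le_of (lmeet L) (x \<squnion> y) z \<longleftrightarrow> le_of (lmeet L) x z \<and> le_of (lmeet L) y z"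
  by (meson join_le le_trans join_closed le_join1 le_join2)

lemma join_diff_distrib:
  "\<lbrakk>a \<in> carrier L; b \<in> carrier L; c \<in> carrier L\<rbrakk> \<Longrightarrow> (a \<squnion> b) \<setminus> c = (a \<setminus> c) \<sqinter> (b \<setminus> c)"
  by (rule eq_by_lower_bounds) (simp_all add: le_diff_iff distrib le_meet_iff join_le_iff)

lemma meet_join_distrib_right:
  "\<lbrakk>a \<in> carrier L; b \<in> carrier L; c \<in> carrier L\<rbrakk> \<Longrightarrow> (a \<squnion> b) \<sqinter> c = (a \<sqinter> c) \<squnion> (b \<sqinter> c)"
  by (simp add: distrib meet_comm[of _ c])

lemma peirce:
  assumes [simp]: "a \<in> carrier L" "b \<in> carrier L"
  shows "(a \<setminus> b) \<setminus> a = a"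
proof (rule le_antisym)
  let ?d = "(a \<setminus> b) \<setminus> a"
  have "?d = (?d \<sqinter> a) \<squnion> (?d \<sqinter> (a \<setminus> b))"
    by (metis assms diff_closed distrib join_diff meet_one)
  \<comment> \<open>The residuated form of reflexivity of \<open>?d\<close>.\<close>
  moreover have "le_of (lmeet L) (?d \<sqinter> (a \<setminus> b)) a"
    by (simp add: le_refl flip: le_diff_iff)
  ultimately show "le_of (lmeet L) ?d a"
    by (metis assms diff_closed join_le meet_closed meet_le2)
  show "le_of (lmeet L) a ?d" by (simp add: le_diff_iff meet_le1)
qed simp_all

text \<open>First coordinate of (IB5): \<open>a \<sqinter> (a \<setminus> b)\<close> lies below
  \<open>a \<sqinter> b\<close>, so residuation puts \<open>a\<close> below the outer
  difference.\<close>

lemma meet_diff_diff: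
  "\<lbrakk>a \<in> carrier L; b \<in> carrier L\<rbrakk> \<Longrightarrow> a \<sqinter> ((a \<setminus> b) \<setminus> (a \<sqinter> b)) = a"
  using le_diff_iff[of "a \<setminus> b" "a \<sqinter> b" a] by (simp add: meet_diff le_refl) (simp add: le_of_def)

lemma prod_bilattice_t:
  "lattice_on (carrier (prod_implicative L)) (tmeet (prod_implicative L)) (tjoin (prod_implicative L))"
  by unfold_locales (auto simp: nonempty meet_assoc join_assoc meet_join_absorb join_meet_absorb
      intro: meet_comm join_comm)

lemma prod_bilattice_k:
  "lattice_on (carrier (prod_implicative L)) (kmeet (prod_implicative L)) (kjoin (prod_implicative L))"
  by unfold_locales (auto simp: nonempty meet_assoc join_assoc meet_join_absorb join_meet_absorb
      intro: meet_comm join_comm)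

lemma prod_implicative_bilattice: "implicative_bilattice (prod_implicative L)"
proof -
  let ?P = "prod_implicative L"
  interpret t: lattice_on "carrier ?P" "tmeet ?P" "tjoin ?P" by (rule prod_bilattice_t)
  interpret k: lattice_on "carrier ?P" "kmeet ?P" "kjoin ?P" by (rule prod_bilattice_k)
  show ?thesis
  proof unfold_locales
    fix x y assume "x \<in> carrier ?P" "y \<in> carrier ?P" "le_of (tmeet ?P) x y"
    then show "le_of (tmeet ?P) (neg ?P y) (neg ?P x)"
      by (cases x; cases y) (auto simp: le_of_def;
          metis join_comm meet_join_absorb join_meet_absorb meet_comm)
  next
    fix x y assume "x \<in> carrier ?P" "y \<in> carrier ?P"
    \<comment> \<open>In the second coordinate, the second component of \<open>x\<close> is joined
      with a meet having it as a factor, so absorption applies.\<close>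
    then show "tmeet ?P x (impl ?P (impl ?P x y) (kmeet ?P x y)) = x"
      by (auto simp: meet_diff_diff)
        (metis diff_closed join_meet_absorb meet_assoc meet_closed meet_comm)
  qed (auto simp: le_of_def one_diff diff_self one_meet diff_diff meet_assoc peirce
      join_diff_distrib meet_join_distrib_right)
qed

end

section \<open>Transport along isomorphisms\<close>

text \<open>Each lattice law is an equation, so it can be checked after applying the injective
  homomorphism \<open>f\<close>.\<close>

lemma lattice_on_transport:
  assumes "lattice_on C m' j'" and inj: "inj_on f A" and img: "f ` A \<subseteq> C" and "A \<noteq> {}"
    and cl: "\<And>x y. \<lbrakk>x \<in> A; y \<in> A\<rbrakk> \<Longrightarrow> m x y \<in> A" "\<And>x y. \<lbrakk>x \<in> A; y \<in> A\<rbrakk> \<Longrightarrow> j x y \<in> A"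
    and hom: "\<And>x y. \<lbrakk>x \<in> A; y \<in> A\<rbrakk> \<Longrightarrow> f (m x y) = m' (f x) (f y)"
      "\<And>x y. \<lbrakk>x \<in> A; y \<in> A\<rbrakk> \<Longrightarrow> f (j x y) = j' (f x) (f y)"
  shows "lattice_on A m j"
proof -
  interpret C: lattice_on C m' j' by fact
  have C [simp]: "f x \<in> C" if "x \<in> A" for x using img that by blast
  note simps = cl hom C.meet_assoc C.join_assoc C.meet_join_absorb C.join_meet_absorb
  show ?thesis
  proof
    show "A \<noteq> {}" by fact
    show "m x y = m y x" if "x \<in> A" "y \<in> A" for x y
      by (rule inj_onD[OF inj]) (use that in \<open>simp_all add: cl hom C.meet_comm\<close>)
    show "j x y = j y x" if "x \<in> A" "y \<in> A" for x y
      by (rule inj_onD[OF inj]) (use that in \<open>simp_all add: cl hom C.join_comm\<close>)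
  qed (rule cl inj_onD[OF inj]; simp add: simps)+
qed

lemma implicative_bilattice_transport:
  assumes "implicative_algebra B" "implicative_bilattice P" "alg_isomorphic B P"
  shows "implicative_bilattice B"
proof -
  interpret B: implicative_algebra B by fact
  interpret P: implicative_bilattice P by fact
  obtain f where bij: "bij_betw f (carrier B) (carrier P)"
    and hom: "\<And>x y. \<lbrakk>x \<in> carrier B; y \<in> carrier B\<rbrakk> \<Longrightarrow> f (x \<curlywedge>\<^bsub>B\<^esub> y) = f x \<curlywedge>\<^bsub>P\<^esub> f y"
      "\<And>x y. \<lbrakk>x \<in> carrier B; y \<in> carrier B\<rbrakk> \<Longrightarrow> f (x \<curlyvee>\<^bsub>B\<^esub> y) = f x \<curlyvee>\<^bsub>P\<^esub> f y"
      "\<And>x y. \<lbrakk>x \<in> carrier B; y \<in> carrier B\<rbrakk> \<Longrightarrow> f (x \<otimes>\<^bsub>B\<^esub> y) = f x \<otimes>\<^bsub>P\<^esub> f y"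
      "\<And>x y. \<lbrakk>x \<in> carrier B; y \<in> carrier B\<rbrakk> \<Longrightarrow> f (x \<oplus>\<^bsub>B\<^esub> y) = f x \<oplus>\<^bsub>P\<^esub> f y"
      "\<And>x y. \<lbrakk>x \<in> carrier B; y \<in> carrier B\<rbrakk> \<Longrightarrow> f (x \<sqsupset>\<^bsub>B\<^esub> y) = f x \<sqsupset>\<^bsub>P\<^esub> f y"
      "\<And>x. x \<in> carrier B \<Longrightarrow> f (\<sim>\<^bsub>B\<^esub> x) = \<sim>\<^bsub>P\<^esub> (f x)"
    using assms(3) unfolding alg_isomorphic_def by blast
  have inj: "inj_on f (carrier B)" using bij by (simp add: bij_betw_def)
  have img: "f ` carrier B \<subseteq> carrier P" using bij by (simp add: bij_betw_def)
  have fP [simp]: "f x \<in> carrier P" if "x \<in> carrier B" for x using img that by blast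
  note cl = B.tmeet_closed B.tjoin_closed B.kmeet_closed B.kjoin_closed B.neg_closed B.impl_closed
  \<comment> \<open>The two order conditions on negation are implications, so \<open>f\<close> must
    reflect the orders as well as preserve them.\<close>
  have le_t: "le_of (tmeet B) x y \<longleftrightarrow> le_of (tmeet P) (f x) (f y)"
    and le_k: "le_of (kmeet B) x y \<longleftrightarrow> le_of (kmeet P) (f x) (f y)"
    if "x \<in> carrier B" "y \<in> carrier B" for x y
    unfolding le_of_def using that inj
    by (metis cl hom(1) inj_onD, metis cl hom(3) inj_onD)
  interpret t: lattice_on "carrier B" "tmeet B" "tjoin B"
    by (rule lattice_on_transport[OF P.t.lattice_on_axioms inj img B.nonempty])
      (simp_all add: cl hom)
  interpret k: lattice_on "carrier B" "kmeet B" "kjoin B"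
    by (rule lattice_on_transport[OF P.k.lattice_on_axioms inj img B.nonempty])
      (simp_all add: cl hom)
  show ?thesis
  proof unfold_locales
    fix x y z assume [simp]: "x \<in> carrier B" "y \<in> carrier B" "z \<in> carrier B"
    note [simp] = cl hom
    show "x \<sqsupset>\<^bsub>B\<^esub> (y \<sqsupset>\<^bsub>B\<^esub> z) = (x \<curlywedge>\<^bsub>B\<^esub> y) \<sqsupset>\<^bsub>B\<^esub> z"
      by (rule inj_onD[OF inj]) (simp_all add: P.IB2_t)
    show "(x \<curlywedge>\<^bsub>B\<^esub> y) \<sqsupset>\<^bsub>B\<^esub> z = (x \<otimes>\<^bsub>B\<^esub> y) \<sqsupset>\<^bsub>B\<^esub> z"
      by (rule inj_onD[OF inj]) (simp_all add: P.IB2_k)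
    show "(x \<curlyvee>\<^bsub>B\<^esub> y) \<sqsupset>\<^bsub>B\<^esub> z = (x \<sqsupset>\<^bsub>B\<^esub> z) \<curlywedge>\<^bsub>B\<^esub> (y \<sqsupset>\<^bsub>B\<^esub> z)"
      by (rule inj_onD[OF inj]) (simp_all add: P.IB4_t)
    show "(x \<sqsupset>\<^bsub>B\<^esub> z) \<curlywedge>\<^bsub>B\<^esub> (y \<sqsupset>\<^bsub>B\<^esub> z) = (x \<oplus>\<^bsub>B\<^esub> y) \<sqsupset>\<^bsub>B\<^esub> z"
      by (rule inj_onD[OF inj]) (simp_all add: P.IB4_k)
    show "(\<sim>\<^bsub>B\<^esub> (x \<sqsupset>\<^bsub>B\<^esub> y)) \<sqsupset>\<^bsub>B\<^esub> z = (x \<curlywedge>\<^bsub>B\<^esub> (\<sim>\<^bsub>B\<^esub> y)) \<sqsupset>\<^bsub>B\<^esub> z"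
      by (rule inj_onD[OF inj]) (simp_all add: P.IB6)
  next
    fix x y assume [simp]: "x \<in> carrier B" "y \<in> carrier B"
    note [simp] = cl hom
    show "(x \<sqsupset>\<^bsub>B\<^esub> x) \<sqsupset>\<^bsub>B\<^esub> y = y"
      by (rule inj_onD[OF inj]) (simp_all add: P.IB1)
    show "((x \<sqsupset>\<^bsub>B\<^esub> y) \<sqsupset>\<^bsub>B\<^esub> x) \<sqsupset>\<^bsub>B\<^esub> x = x \<sqsupset>\<^bsub>B\<^esub> x"
      by (rule inj_onD[OF inj]) (simp_all add: P.IB3)
    show "x \<curlywedge>\<^bsub>B\<^esub> ((x \<sqsupset>\<^bsub>B\<^esub> y) \<sqsupset>\<^bsub>B\<^esub> (x \<otimes>\<^bsub>B\<^esub> y)) = x"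
      by (rule inj_onD[OF inj]) (simp_all add: P.IB5)
    show "\<sim>\<^bsub>B\<^esub> (\<sim>\<^bsub>B\<^esub> x) = x"
      by (rule inj_onD[OF inj]) (simp_all add: P.neg_neg)
  qed (simp_all add: cl le_t le_k hom P.neg_antitone_t P.neg_monotone_k)
qed

text \<open>The factor can be found over the element type of \<open>B\<close> because it is realised
  on a subset of \<open>carrier B\<close>. The separate type \<open>'c\<close> lets the converse
  cover a factor over any type, which cannot be quantified inside the formula.\<close>

theorem theorem5p1p5:
  fixes B :: "'a implicative_alg"
  assumes "implicative_algebra B"
  shows "(implicative_bilattice B \<longleftrightarrow>
           (\<exists>L :: 'a cil_alg. classical_implicative_lattice L \<and>
              alg_isomorphic B (prod_implicative L))) \<and>
         ((\<exists>L :: 'c cil_alg. classical_implicative_lattice L \<and>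
              alg_isomorphic B (prod_implicative L)) \<longrightarrow>
           implicative_bilattice B)"
proof (intro conjI iffI impI)
  assume "implicative_bilattice B"
  then show "\<exists>L :: 'a cil_alg. classical_implicative_lattice L \<and>
      alg_isomorphic B (prod_implicative L)"
    using implicative_bilattice.regular_lattice_classical regular_lattice_isomorphic by blast
qed (auto intro: implicative_bilattice_transport[OF assms]
    classical_implicative_lattice.prod_implicative_bilattice)

end
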